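(* Let $A,B,X\in M_n(\mathbb C)$ with $A$ and $B$ positive definite, let $\lambda_1,\dots,\lambda_n$ be the eigenvalues of $A$ and $\nu_1,\dots,\nu_n$ the eigenvalues of $B$, and let $$\underline{\mathrm K}=\min\bigl\{\mathrm{K}\bigl((\lambda_i/\nu_j)^{1/2},2\bigr): i,j=1,2,\dots,n\bigr\}.$$ Let $v\in(0,1)$ and put $r=\min\{v,1-v\}$, $r_1=\min\{2r,1-2r\}$ and $\hat r_1=\min\{2r_1,1-2r_1\}$. (I) If $0<v\le\frac12$, then $$\|(1-v)AX+vXB\|_F^2-v^2\|AX-XB\|_F^2\ \ge\ r_1\|A^{1/2}XB^{1/2}-AX\|_F^2+\underline{\mathrm K}^{\hat r_1}\|A^{1-v}XB^v\|_F^2.$$ (II) If $\frac12<v<1$, then $$\|(1-v)AX+vXB\|_F^2-(1-v)^2\|AX-XB\|_F^2\ \ge\ r_1\|A^{1/2}XB^{1/2}-XB\|_F^2+\underline{\mathrm K}^{\hat r_1}\|A^{1-v}XB^v\|_F^2.$$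
   Context: $M_n(\mathbb C)$ is the algebra of $n\times n$ complex matrices and $\|\cdot\|_F$ is the Hilbert-Schmidt (Frobenius) norm. For $t>0$, $\mathrm{K}(t,2)=\frac{(t+1)^2}{4t}$ denotes the Kantorovich constant. *)

theory Defs
  imports
    Complex_Main
    "Jordan_Normal_Form.Char_Poly"
    "Jordan_Normal_Form.Schur_Decomposition"
begin

definition frobenius_norm :: "complex mat \<Rightarrow> real" where
  "frobenius_norm M = sqrt (\<Sum>i<dim_row M. \<Sum>j<dim_col M. (cmod (M $$ (i, j)))\<^sup>2)"

definition positive_definite :: "nat \<Rightarrow> complex mat \<Rightarrow> bool" where
  "positive_definite n A \<longleftrightarrow>
     A \<in> carrier_mat n n \<and> mat_adjoint A = A \<and>
     (\<forall>x \<in> carrier_vec n. x \<noteq> 0\<^sub>v n \<longrightarrow> 0 < Re ((A *\<^sub>v x) \<bullet>c x))"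

definition unitary_mat :: "nat \<Rightarrow> complex mat \<Rightarrow> bool" where
  "unitary_mat n U \<longleftrightarrow> U \<in> carrier_mat n n \<and> mat_adjoint U * U = 1\<^sub>m n"

definition real_diag :: "nat \<Rightarrow> (nat \<Rightarrow> real) \<Rightarrow> complex mat" where
  "real_diag n d = mat_diag n (\<lambda>i. complex_of_real (d i))"

text \<open>
  Real powers by functional calculus. The value does not depend on the chosen
  unitary diagonalization, see \<open>mat_rpow_eq\<close> below; it is only meaningful for positive
  definite matrices (for which a diagonalization exists).
\<close>

definition mat_rpow :: "complex mat \<Rightarrow> real \<Rightarrow> complex mat" where
  "mat_rpow A s = (THE P. \<exists>U d. unitary_mat (dim_row A) U \<and> (\<forall>i<dim_row A. 0 < d i) \<and>
     A = U * real_diag (dim_row A) d * mat_adjoint U \<and>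
     P = U * real_diag (dim_row A) (\<lambda>i. d i powr s) * mat_adjoint U)"

text \<open>The Kantorovich constant $K(t,2)$.\<close>

definition kantorovich2 :: "real \<Rightarrow> real" where
  "kantorovich2 t = (t + 1)\<^sup>2 / (4 * t)"

lemma mat_adjoint_carrier [simp]: "A \<in> carrier_mat n m \<Longrightarrow> mat_adjoint A \<in> carrier_mat m n"
  by (rule carrier_matI) (simp_all add: mat_adjoint_def)

lemma real_diag_carrier [simp]: "real_diag n d \<in> carrier_mat n n"
  by (simp add: real_diag_def)

lemma unitary_mat_right:
  assumes "unitary_mat n U"
  shows "U * mat_adjoint U = 1\<^sub>m n"
proof (rule mat_mult_left_right_inverse)
  show U: "U \<in> carrier_mat n n" and "mat_adjoint U * U = 1\<^sub>m n"
    using assms by (simp_all add: unitary_mat_def)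
  show "mat_adjoint U \<in> carrier_mat n n" using U by (rule mat_adjoint_carrier)
qed

lemma real_diag_intertwine:
  assumes W: "W \<in> carrier_mat n n"
    and eq: "real_diag n e * W = W * real_diag n d"
  shows "real_diag n (\<lambda>i. f (e i)) * W = W * real_diag n (\<lambda>i. f (d i))"
proof (rule eq_matI)
  fix i j
  assume "i < dim_row (W * real_diag n (\<lambda>i. f (d i)))"
    and "j < dim_col (W * real_diag n (\<lambda>i. f (d i)))"
  then have i: "i < n" and j: "j < n" using W by (auto simp: real_diag_def mat_diag_def)
  have "(real_diag n e * W) $$ (i, j) = (W * real_diag n d) $$ (i, j)" by (simp only: eq)
  then have "complex_of_real (e i) * W $$ (i, j) = W $$ (i, j) * complex_of_real (d j)"
    unfolding real_diag_def mat_diag_mult_left[OF W] mat_diag_mult_right[OF W] using i j by simp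
  then have "(complex_of_real (e i) - complex_of_real (d j)) * W $$ (i, j) = 0"
    by (simp only: left_diff_distrib mult.commute[of _ "W $$ (i, j)"]) simp
  then have "W $$ (i, j) = 0 \<or> e i = d j" by (simp add: disj_commute)
  then show "(real_diag n (\<lambda>i. f (e i)) * W) $$ (i, j) =
      (W * real_diag n (\<lambda>i. f (d i))) $$ (i, j)"
    unfolding real_diag_def mat_diag_mult_left[OF W] mat_diag_mult_right[OF W]
    using i j by (elim disjE) simp_all
qed (use W in \<open>auto simp: real_diag_def mat_diag_def\<close>)

lemma functional_calculus_unique:
  assumes U: "unitary_mat n U" and V: "unitary_mat n V"
    and eq: "U * real_diag n d * mat_adjoint U = V * real_diag n e * mat_adjoint V"
  shows "U * real_diag n (\<lambda>i. f (d i)) * mat_adjoint U =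
    V * real_diag n (\<lambda>i. f (e i)) * mat_adjoint V"
proof -
  define U' where "U' = mat_adjoint U"
  define V' where "V' = mat_adjoint V"
  have c [simp]: "U \<in> carrier_mat n n" "V \<in> carrier_mat n n"
    "U' \<in> carrier_mat n n" "V' \<in> carrier_mat n n"
    using U V by (auto simp: unitary_mat_def U'_def V'_def)
  have l: "U' * U = 1\<^sub>m n" "V' * V = 1\<^sub>m n"
    using U V by (auto simp: unitary_mat_def U'_def V'_def)
  have r: "U * U' = 1\<^sub>m n" "V * V' = 1\<^sub>m n"
    using unitary_mat_right[OF U] unitary_mat_right[OF V] by (auto simp: U'_def V'_def)
  have assoc: "P * Q * R = P * (Q * R)"
    if "P \<in> carrier_mat n n" "Q \<in> carrier_mat n n" "R \<in> carrier_mat n n" for P Q R :: "complex mat"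
    using that by (rule assoc_mult_mat)
  have cancel: "U' * (U * Q) = Q" "V' * (V * Q) = Q" "U * (U' * Q) = Q" "V * (V' * Q) = Q"
    if "Q \<in> carrier_mat n n" for Q :: "complex mat"
    using that l r assoc[of U' U Q] assoc[of V' V Q] assoc[of U U' Q] assoc[of V V' Q] by simp_all
  have mc: "P * Q \<in> carrier_mat n n"
    if "P \<in> carrier_mat n n" "Q \<in> carrier_mat n n" for P Q :: "complex mat"
    using that by (rule mult_carrier_mat)
  have eq': "U * (real_diag n d * U') = V * (real_diag n e * V')"
    using eq by (simp add: U'_def[symmetric] V'_def[symmetric] assoc mc)
  have "real_diag n e * (V' * U) = V' * (V * (real_diag n e * V')) * U"
    by (simp add: assoc mc cancel)
  also have "\<dots> = V' * (U * (real_diag n d * U')) * U" by (simp only: eq')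
  also have "\<dots> = (V' * U) * real_diag n d" by (simp add: assoc mc l right_mult_one_mat[of _ n n])
  finally have comm: "real_diag n e * (V' * U) = (V' * U) * real_diag n d" .
  have W: "real_diag n (\<lambda>i. f (e i)) * (V' * U) = (V' * U) * real_diag n (\<lambda>i. f (d i))"
    by (rule real_diag_intertwine[where e = e and d = d and f = f, OF _ comm]) (rule mc; simp)
  have "V * real_diag n (\<lambda>i. f (e i)) * V' = V * (real_diag n (\<lambda>i. f (e i)) * (V' * U)) * U'"
    by (simp add: assoc mc r right_mult_one_mat[of _ n n])
  also have "\<dots> = U * real_diag n (\<lambda>i. f (d i)) * U'"
    by (simp only: W) (simp add: assoc mc cancel)
  finally show ?thesis by (simp add: U'_def V'_def)
qed

lemma mat_rpow_eq:
  assumes U: "unitary_mat n U" and d: "\<forall>i<n. 0 < d i"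
    and A: "A = U * real_diag n d * mat_adjoint U"
  shows "mat_rpow A s = U * real_diag n (\<lambda>i. d i powr s) * mat_adjoint U"
proof -
  have n: "dim_row A = n" using U unfolding A unitary_mat_def by auto
  show ?thesis
    unfolding mat_rpow_def n
  proof (rule the_equality)
    show "\<exists>U' d'. unitary_mat n U' \<and> (\<forall>i<n. 0 < d' i) \<and>
       A = U' * real_diag n d' * mat_adjoint U' \<and>
       U * real_diag n (\<lambda>i. d i powr s) * mat_adjoint U =
       U' * real_diag n (\<lambda>i. d' i powr s) * mat_adjoint U'"
      by (rule exI[of _ U], rule exI[of _ d]) (intro conjI U d A refl)
  next
    fix P
    assume "\<exists>V e. unitary_mat n V \<and> (\<forall>i<n. 0 < e i) \<and> A = V * real_diag n e * mat_adjoint V \<and>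
       P = V * real_diag n (\<lambda>i. e i powr s) * mat_adjoint V"
    then obtain V e where V: "unitary_mat n V" and AV: "A = V * real_diag n e * mat_adjoint V"
      and P: "P = V * real_diag n (\<lambda>i. e i powr s) * mat_adjoint V"
      by blast
    have "V * real_diag n e * mat_adjoint V = U * real_diag n d * mat_adjoint U"
      using A AV by simp
    from functional_calculus_unique[OF V U this, of "\<lambda>x. x powr s"]
    show "P = U * real_diag n (\<lambda>i. d i powr s) * mat_adjoint U" by (simp add: P)
  qed
qed

end

theory Submission
  imports Defs "HOL-Analysis.Convex" "Jordan_Normal_Form.Spectral_Radius"
begin

unbundle no inner_syntax

text \<open>
  In orthonormal eigenbases of A and B every matrix in the theorem has entries
  $c(\lambda_i, \nu_j)\, y_{ij}$ with the same $y_{ij}$, and the Frobenius norm is unitarily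
  invariant, so the theorem reduces to a scalar inequality for each pair of eigenvalues; (II) is
  (I) with the two eigenvalues exchanged and $v$ replaced by $1 - v$. For weights
  $w \le \frac12$ one has $K(p/q,2)^w\, p^{1-w} q^w = (\frac{p+q}2)^{2w}\, p^{1-2w}$, which by
  weighted AM-GM is at most $(1-w)p + wq$. Applied to $x^2$ and $xy$ with weight $2s$ this refines
  to Young's inequality for $x^2$ and $y^2$ with the remainder $s(x-y)^2$.
\<close>

section \<open>Scalar Young inequalities with the Kantorovich constant\<close>

lemma kantorovich2_ge_1:
  assumes "0 < t"
  shows "1 \<le> kantorovich2 t"
proof -
  have "0 \<le> (t - 1)\<^sup>2" by simp
  then have "4 * t \<le> (t + 1)\<^sup>2" by (simp add: power2_eq_square algebra_simps)
  with assms show ?thesis by (simp add: kantorovich2_def)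
qed

lemma kantorovich2_inverse: "0 < t \<Longrightarrow> kantorovich2 (1 / t) = kantorovich2 t"
  by (simp add: kantorovich2_def field_simps power2_eq_square)

lemma kantorovich2_divide: "0 < p \<Longrightarrow> 0 < q \<Longrightarrow> kantorovich2 (p / q) = (p + q)\<^sup>2 / (4 * p * q)"
  by (simp add: kantorovich2_def field_simps power2_eq_square)

lemma Young_kantorovich_half:
  fixes p q w :: real
  assumes p: "0 < p" and q: "0 < q" and w: "0 \<le> w" "w \<le> 1/2"
  shows "kantorovich2 (p / q) powr w * (p powr (1 - w) * q powr w) \<le> (1 - w) * p + w * q"
proof -
  let ?m = "(p + q) / 2"
  have m: "0 < ?m" using p q by simp
  have eq: "(p + q)\<^sup>2 / (4 * p * q) = ?m\<^sup>2 * (inverse p * inverse q)"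
    using p q by (simp add: field_simps power2_eq_square)
  have ex: "ln (kantorovich2 (p / q)) = 2 * ln ?m - ln p - ln q"
    unfolding kantorovich2_divide[OF p q] eq
    using p q m by (simp add: ln_mult ln_inverse ln_realpow)
  \<comment> \<open>\<open>powr_def\<close> treats base 0 separately, so positivity must be known
    before passing to exponentials.\<close>
  have "0 < kantorovich2 (p / q)" using kantorovich2_ge_1[of "p / q"] p q by simp
  then have "kantorovich2 (p / q) powr w * (p powr (1 - w) * q powr w) =
      exp (w * (2 * ln ?m - ln p - ln q) + ((1 - w) * ln p + w * ln q))"
    using p q ex by (simp add: powr_def exp_add)
  \<comment> \<open>In the exponent \<open>w * ln q\<close> cancels, and \<open>ln p\<close> keeps
    the coefficient \<open>1 - 2 * w\<close>.\<close>
  also have "\<dots> = ?m powr (2 * w) * p powr (1 - 2 * w)"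
    using p q m by (simp add: powr_def flip: exp_add) (simp add: algebra_simps)
  also have "\<dots> \<le> (2 * w) * ?m + (1 - 2 * w) * p"
    using w m p by (intro Youngs_inequality_0) auto
  also have "\<dots> = (1 - w) * p + w * q" by (simp add: algebra_simps add_divide_distrib)
  finally show ?thesis .
qed

text \<open>Exchanging p and q while replacing w by 1 - w changes neither side, because the constant
  is invariant under inversion of the ratio. This reduces weights above 1/2 to the previous
  case.\<close>

lemma Young_kantorovich:
  fixes p q w :: real
  assumes p: "0 < p" and q: "0 < q" and w: "0 \<le> w" "w \<le> 1"
  shows "kantorovich2 (p / q) powr min w (1 - w) * (p powr (1 - w) * q powr w) \<le> (1 - w) * p + w * q"
proof (cases "w \<le> 1/2")
  case True
  then show ?thesis using Young_kantorovich_half[OF p q w(1) True] by (simp add: min_def)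
next
  case False
  have "kantorovich2 (q / p) = kantorovich2 (p / q)"
    using kantorovich2_inverse[of "p / q"] p q by simp
  then show ?thesis using False w Young_kantorovich_half[OF q p, of "1 - w"]
    by (simp add: min_def mult.commute add.commute)
qed

text \<open>For s at most 1/2, moving s(x-y)^2 to the right leaves (1-2s)x^2 + 2s xy, the weighted
  arithmetic mean of x^2 and xy. The quotient of these two numbers is again x/y, so the argument of
  the constant is unchanged. Larger s follow by exchanging x and y.\<close>

lemma refined_Young_kantorovich:
  fixes x y s :: real
  assumes x: "0 < x" and y: "0 < y" and s: "0 \<le> s" "s \<le> 1"
  defines "r \<equiv> min s (1 - s)"
  shows "r * (x - y)\<^sup>2 + kantorovich2 (x / y) powr min (2 * r) (1 - 2 * r) *
      (x powr (1 - s) * y powr s)\<^sup>2 \<le> (1 - s) * x\<^sup>2 + s * y\<^sup>2"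
proof -
  have half: "s * (x - y)\<^sup>2 + kantorovich2 (x / y) powr min (2 * s) (1 - 2 * s) *
      (x powr (1 - s) * y powr s)\<^sup>2 \<le> (1 - s) * x\<^sup>2 + s * y\<^sup>2"
    if x: "0 < x" and y: "0 < y" and s: "0 \<le> s" "s \<le> 1/2" for x y s :: real
  proof -
    have e: "x\<^sup>2 powr (1 - 2 * s) * (x * y) powr (2 * s) = (x powr (1 - s) * y powr s)\<^sup>2"
      using x y by (simp add: powr_def ln_mult ln_realpow power2_eq_square flip: exp_add)
        (simp add: algebra_simps)
    have "kantorovich2 (x\<^sup>2 / (x * y)) powr min (2 * s) (1 - 2 * s) *
        (x\<^sup>2 powr (1 - 2 * s) * (x * y) powr (2 * s)) \<le> (1 - 2 * s) * x\<^sup>2 + 2 * s * (x * y)"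
      using x y s by (intro Young_kantorovich) auto
    moreover have "x\<^sup>2 / (x * y) = x / y" using x by (simp add: power2_eq_square)
    ultimately show ?thesis unfolding e by (simp add: power2_eq_square algebra_simps)
  qed
  show ?thesis
  proof (cases "s \<le> 1/2")
    case True
    then show ?thesis using half[OF x y s(1) True] by (simp add: r_def min_def)
  next
    case False
    have "kantorovich2 (y / x) = kantorovich2 (x / y)"
      using kantorovich2_inverse[of "x / y"] x y by simp
    moreover have "r = 1 - s" using False by (simp add: r_def)
    ultimately show ?thesis using False s half[OF y x, of "1 - s"]
      by (simp add: mult.commute add.commute power2_commute)
  qed
qed

text \<open>
  The right-hand side equals $(1-2v)a^2 + 2v\,ab$, so this is the refined Young inequality for
  $x = a$, $y = \sqrt{ab}$ and weight $2v$.
\<close>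

lemma Young_kantorovich_sq_diff:
  fixes a b v k :: real
  assumes a: "0 < a" and b: "0 < b" and v: "0 < v" "v \<le> 1/2"
  defines "r \<equiv> min (2 * v) (1 - 2 * v)"
  assumes k: "0 \<le> k" "k \<le> kantorovich2 ((a / b) powr (1/2))"
  shows "r * (a powr (1/2) * b powr (1/2) - a)\<^sup>2 +
      k powr min (2 * r) (1 - 2 * r) * (a powr (1 - v) * b powr v)\<^sup>2
    \<le> ((1 - v) * a + v * b)\<^sup>2 - v\<^sup>2 * (a - b)\<^sup>2"
proof -
  let ?g = "a powr (1/2) * b powr (1/2)"
  have g: "0 < ?g" using a b by simp
  have g2: "?g\<^sup>2 = a * b"
    using a b by (simp add: power_mult_distrib powr_half_sqrt)
  have q: "a / ?g = (a / b) powr (1/2)"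
    using a b by (simp add: powr_half_sqrt real_sqrt_divide field_simps)
  have e: "a powr (1 - 2 * v) * ?g powr (2 * v) = a powr (1 - v) * b powr v"
    using a b by (simp add: powr_def ln_mult flip: exp_add) (simp add: algebra_simps)
  \<comment> \<open>Here r is at most 1/2, being the smaller of two numbers with sum 1. The exponent
    is therefore nonnegative and the power is monotone in its base, which lets k replace the
    constant.\<close>
  have "0 \<le> min (2 * r) (1 - 2 * r)" using v by (auto simp: r_def min_def)
  then have "k powr min (2 * r) (1 - 2 * r) \<le>
      kantorovich2 ((a / b) powr (1/2)) powr min (2 * r) (1 - 2 * r)"
    using k by (intro powr_mono2) auto
  then have "k powr min (2 * r) (1 - 2 * r) * (a powr (1 - v) * b powr v)\<^sup>2 \<le>
      kantorovich2 ((a / b) powr (1/2)) powr min (2 * r) (1 - 2 * r) * (a powr (1 - v) * b powr v)\<^sup>2"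
    by (rule mult_right_mono) simp
  moreover have "r * (a - ?g)\<^sup>2 + kantorovich2 (a / ?g) powr min (2 * r) (1 - 2 * r) *
      (a powr (1 - 2 * v) * ?g powr (2 * v))\<^sup>2 \<le> (1 - 2 * v) * a\<^sup>2 + 2 * v * ?g\<^sup>2"
    unfolding r_def using a g v by (intro refined_Young_kantorovich) auto
  moreover have "((1 - v) * a + v * b)\<^sup>2 - v\<^sup>2 * (a - b)\<^sup>2 = (1 - 2 * v) * a\<^sup>2 + 2 * v * (a * b)"
    by (simp add: power2_eq_square algebra_simps)
  ultimately show ?thesis unfolding q e g2 by (simp add: power2_commute[of a])
qed

section \<open>Adjoints, block matrices and unitary matrices\<close>

text \<open>With n instantiated, associativity becomes a usable rewrite rule: no intermediate
  dimension has to be guessed.\<close>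

lemma square_mat_mult_simps:
  fixes M N P :: "'a :: semiring_0 mat"
  assumes "M \<in> carrier_mat n n" "N \<in> carrier_mat n n"
  shows "M * N \<in> carrier_mat n n"
    and "P \<in> carrier_mat n n \<Longrightarrow> M * N * P = M * (N * P)"
  using assms by auto

lemma mat_adjoint_dim [simp]:
  "dim_row (mat_adjoint M) = dim_col M" "dim_col (mat_adjoint M) = dim_row M"
  by (simp_all add: mat_adjoint_def)

lemma mat_adjoint_index [simp]:
  "i < dim_col M \<Longrightarrow> j < dim_row M \<Longrightarrow> mat_adjoint M $$ (i, j) = conjugate (M $$ (j, i))"
  by (simp add: mat_adjoint_def mat_of_rows_index)

lemma mat_adjoint_adjoint [simp]: "mat_adjoint (mat_adjoint M) = M"
  by (rule eq_matI) auto

lemma mat_adjoint_one [simp]: "mat_adjoint (1\<^sub>m n :: complex mat) = 1\<^sub>m n"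
  by (rule eq_matI) auto

lemma mat_adjoint_mult:
  fixes M N :: "complex mat"
  assumes "M \<in> carrier_mat m n" "N \<in> carrier_mat n k"
  shows "mat_adjoint (M * N) = mat_adjoint N * mat_adjoint M"
  using assms by (intro eq_matI) (auto simp: scalar_prod_def mult.commute intro!: sum.cong)

text \<open>The columns appear in reversed order because the scalar product conjugates its second
  argument.\<close>

lemma mat_adjoint_mult_self_index:
  fixes M :: "complex mat"
  assumes "i < dim_col M" "j < dim_col M"
  shows "(mat_adjoint M * M) $$ (i, j) = col M j \<bullet>c col M i"
  using assms by (simp add: scalar_prod_def mult.commute)

lemma mat_adjoint_four_block:
  fixes M N P Q :: "complex mat"
  assumes "M \<in> carrier_mat nr1 nc1" "N \<in> carrier_mat nr1 nc2"
    "P \<in> carrier_mat nr2 nc1" "Q \<in> carrier_mat nr2 nc2"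
  shows "mat_adjoint (four_block_mat M N P Q) =
    four_block_mat (mat_adjoint M) (mat_adjoint P) (mat_adjoint N) (mat_adjoint Q)"
  using assms by (intro eq_matI) auto

lemma mult_block_diag_mat:
  fixes M N P Q :: "'a :: semiring_0 mat"
  assumes "M \<in> carrier_mat m m" "N \<in> carrier_mat m m" "P \<in> carrier_mat n n" "Q \<in> carrier_mat n n"
  shows "four_block_mat M (0\<^sub>m m n) (0\<^sub>m n m) P * four_block_mat N (0\<^sub>m m n) (0\<^sub>m n m) Q =
    four_block_mat (M * N) (0\<^sub>m m n) (0\<^sub>m n m) (P * Q)"
proof -
  have "M * N \<in> carrier_mat m m" "P * Q \<in> carrier_mat n n" using assms by auto
  with assms show ?thesis by (subst mult_four_block_mat[of _ m m _ n _ n _ _ m _ n]) auto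
qed

lemma unitary_mat_mult:
  assumes "unitary_mat n U" "unitary_mat n V"
  shows "unitary_mat n (U * V)"
proof -
  have U: "U \<in> carrier_mat n n" "mat_adjoint U * U = 1\<^sub>m n"
    and V: "V \<in> carrier_mat n n" "mat_adjoint V * V = 1\<^sub>m n"
    using assms by (auto simp: unitary_mat_def)
  have "mat_adjoint (U * V) * (U * V) = mat_adjoint V * (mat_adjoint U * U) * V"
    using U(1) V(1) by (simp add: mat_adjoint_mult square_mat_mult_simps[where n = n])
  then show ?thesis using U V by (simp add: unitary_mat_def)
qed

section \<open>Unitary invariance of the Frobenius norm\<close>

lemma frobenius_norm_sq:
  "(frobenius_norm M)\<^sup>2 = (\<Sum>i<dim_row M. \<Sum>j<dim_col M. (cmod (M $$ (i, j)))\<^sup>2)"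
  unfolding frobenius_norm_def by (rule real_sqrt_pow2) (intro sum_nonneg zero_le_power2)

text \<open>The squared norm is the trace of the Gram matrix. In this form it is clear that a
  unitary factor on the left has no effect.\<close>

lemma frobenius_norm_sq_Gram:
  "complex_of_real ((frobenius_norm M)\<^sup>2) = (\<Sum>j<dim_col M. (mat_adjoint M * M) $$ (j, j))"
proof -
  have "(mat_adjoint M * M) $$ (j, j) = (\<Sum>i<dim_row M. complex_of_real ((cmod (M $$ (i, j)))\<^sup>2))"
    if "j < dim_col M" for j
    using that unfolding complex_norm_square
    by (simp add: scalar_prod_def atLeast0LessThan mult.commute)
  then show ?thesis by (simp add: frobenius_norm_sq sum.swap[of _ "{..<dim_row M}"])
qed

lemma frobenius_norm_adjoint: "(frobenius_norm (mat_adjoint M))\<^sup>2 = (frobenius_norm M)\<^sup>2"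
  unfolding frobenius_norm_sq by (simp add: sum.swap[of _ "{..<dim_row M}"])

lemma frobenius_norm_unitary_left:
  assumes U: "unitary_mat n U" and M: "M \<in> carrier_mat n m"
  shows "(frobenius_norm (U * M))\<^sup>2 = (frobenius_norm M)\<^sup>2"
proof -
  have c: "U \<in> carrier_mat n n" "mat_adjoint U * U = 1\<^sub>m n" using U by (auto simp: unitary_mat_def)
  have "mat_adjoint (U * M) * (U * M) = mat_adjoint M * ((mat_adjoint U * U) * M)"
    using c(1) M by (simp add: mat_adjoint_mult[OF c(1) M] assoc_mult_mat[of _ m n _ n _ m]
        assoc_mult_mat[of _ n n _ n _ m])
  then have "mat_adjoint (U * M) * (U * M) = mat_adjoint M * M" using c M by simp
  then have "complex_of_real ((frobenius_norm (U * M))\<^sup>2) = complex_of_real ((frobenius_norm M)\<^sup>2)"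
    unfolding frobenius_norm_sq_Gram using c M by simp
  then show ?thesis by (simp only: of_real_eq_iff)
qed

text \<open>Taking adjoints preserves the norm and moves the right factor to the left, where the
  previous lemma applies.\<close>

lemma frobenius_norm_unitary:
  assumes U: "unitary_mat n U" and V: "unitary_mat m V" and M: "M \<in> carrier_mat n m"
  shows "(frobenius_norm (U * M * mat_adjoint V))\<^sup>2 = (frobenius_norm M)\<^sup>2"
proof -
  have c: "U \<in> carrier_mat n n" "V \<in> carrier_mat m m" using U V by (auto simp: unitary_mat_def)
  have "mat_adjoint (U * M * mat_adjoint V) = V * mat_adjoint (U * M)"
    using c M by (subst mat_adjoint_mult[of _ n m]) auto
  then have "(frobenius_norm (U * M * mat_adjoint V))\<^sup>2 = (frobenius_norm (V * mat_adjoint (U * M)))\<^sup>2"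
    by (metis frobenius_norm_adjoint)
  also have "\<dots> = (frobenius_norm (U * M))\<^sup>2"
    using c M by (subst frobenius_norm_unitary_left[OF V, of _ n]) (auto simp: frobenius_norm_adjoint)
  finally show ?thesis using frobenius_norm_unitary_left[OF U M] by simp
qed

section \<open>The spectral theorem for Hermitian matrices\<close>

text \<open>Complete v to a basis, orthogonalize by Gram-Schmidt starting with v, and normalize. The
  scalar c is the normalizing factor of v.\<close>

lemma unitary_completion:
  fixes v :: "complex vec"
  assumes v: "v \<in> carrier_vec n" "v \<noteq> 0\<^sub>v n"
  obtains U c where "unitary_mat n U" "col U 0 = c \<cdot>\<^sub>v v"
proof -
  interpret cof_vec_space n "TYPE(complex)" .
  have n: "0 < n" using v by (cases n) auto
  define b where "b = basis_completion v"
  define ws where "ws = gram_schmidt n b"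
  note bc = basis_completion[OF v, folded b_def]
  from bc n obtain vs where bv: "b = v # vs" by (cases b) auto
  from gram_schmidt_result[OF bc(2,4,5) refl, folded ws_def] bc
  have ws: "set ws \<subseteq> carrier_vec n" "corthogonal ws" "length ws = n" by auto
  have wsi: "ws ! i \<in> carrier_vec n" if "i < n" for i using ws that by auto
  \<comment> \<open>Gram-Schmidt leaves the first vector unchanged.\<close>
  have hd: "ws ! 0 = v"
    using gram_schmidt_hd[OF v(1), of vs, folded bv] ws n by (metis hd_conv_nth length_0_conv less_irrefl ws_def)
  define s where "s w = complex_of_real (1 / sqrt (Re (w \<bullet>c w)))" for w :: "complex vec"
  define U where "U = mat_of_cols n (map (\<lambda>w. s w \<cdot>\<^sub>v w) ws)"
  have U: "U \<in> carrier_mat n n" unfolding U_def using ws by (auto intro!: carrier_matI)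
  have col: "col U i = s (ws ! i) \<cdot>\<^sub>v (ws ! i)" if "i < n" for i
    unfolding U_def using that ws wsi by (subst col_mat_of_cols) auto
  have "mat_adjoint U * U = 1\<^sub>m n"
  proof (rule eq_matI)
    fix i j assume "i < dim_row (1\<^sub>m n :: complex mat)" "j < dim_col (1\<^sub>m n :: complex mat)"
    then have ij: "i < n" "j < n" by auto
    have "(mat_adjoint U * U) $$ (i, j) = col U j \<bullet>c col U i"
      using carrier_matD[OF U] ij by (simp only: mat_adjoint_mult_self_index)
    also have "\<dots> = cnj (s (ws ! i)) * s (ws ! j) * (ws ! j \<bullet>c ws ! i)"
      unfolding col[OF ij(1)] col[OF ij(2)] conjugate_smult_vec
      using wsi ij
      by (simp add: scalar_prod_smult_distrib[of _ n] smult_scalar_prod_distrib[of _ n])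
    also have "\<dots> = 1\<^sub>m n $$ (i, j)"
    proof (cases "i = j")
      case True
      let ?w = "ws ! j"
      have "?w \<bullet>c ?w \<noteq> 0" using ws(2,3) ij corthogonalD by blast
      \<comment> \<open>In the order on complex numbers, being at least 0 includes being
        real.\<close>
      moreover have "0 \<le> ?w \<bullet>c ?w" by (rule conjugate_square_ge_0_vec)
      ultimately have "0 < Re (?w \<bullet>c ?w)" and "?w \<bullet>c ?w = complex_of_real (Re (?w \<bullet>c ?w))"
        by (auto simp: less_eq_complex_def complex_eq_iff less_le)
      moreover from this(1) have
          "1 / sqrt (Re (?w \<bullet>c ?w)) * (1 / sqrt (Re (?w \<bullet>c ?w))) * Re (?w \<bullet>c ?w) = 1"
        by simp
      ultimately have "s ?w * s ?w * (?w \<bullet>c ?w) = 1"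
        unfolding s_def by (metis of_real_1 of_real_mult)
      moreover have "cnj (s ?w) = s ?w" by (simp add: s_def)
      ultimately show ?thesis using True ij by simp
    next
      case False
      then have "ws ! j \<bullet>c ws ! i = 0" using ws(2,3) ij corthogonalD by blast
      then show ?thesis using False ij by simp
    qed
    finally show "(mat_adjoint U * U) $$ (i, j) = 1\<^sub>m n $$ (i, j)" .
  qed (use U in auto)
  then have "unitary_mat n U" using U by (simp add: unitary_mat_def)
  then show ?thesis using col[OF n] hd that by simp
qed

text \<open>Induction on the dimension. A unitary W whose first column is an eigenvector turns A
  into a Hermitian matrix with first column e times the first unit vector. By symmetry the first row
  has the same form, so this matrix is block diagonal, and the induction hypothesis diagonalizes the
  remaining block.\<close>

lemma hermitian_diagonalization:
  assumes "A \<in> carrier_mat n n" "mat_adjoint A = A"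
  shows "\<exists>U d. unitary_mat n U \<and> A = U * real_diag n d * mat_adjoint U"
  using assms
proof (induction n arbitrary: A)
  case 0
  then show ?case
    by (intro exI[of _ "1\<^sub>m 0"] exI[of _ undefined]) (auto simp: unitary_mat_def intro!: eq_matI)
next
  case (Suc n A)
  note A = Suc.prems(1)
  obtain e where "eigenvalue A e"
    using spectrum_non_empty[OF A] by (auto simp: spectrum_def)
  then obtain v where v: "v \<in> carrier_vec (Suc n)" "v \<noteq> 0\<^sub>v (Suc n)" "A *\<^sub>v v = e \<cdot>\<^sub>v v"
    using A by (auto simp: eigenvalue_def eigenvector_def)
  obtain W c where W: "unitary_mat (Suc n) W" and W0: "col W 0 = c \<cdot>\<^sub>v v"
    using unitary_completion[OF v(1,2)] .
  have Wc: "W \<in> carrier_mat (Suc n) (Suc n)" and WW: "mat_adjoint W * W = 1\<^sub>m (Suc n)"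
    using W by (auto simp: unitary_mat_def)
  have ac: "mat_adjoint W \<in> carrier_mat (Suc n) (Suc n)" using Wc by simp
  note asc = square_mat_mult_simps[where n = "Suc n"]
  define A1 where "A1 = mat_adjoint W * A * W"
  have A1: "A1 \<in> carrier_mat (Suc n) (Suc n)" unfolding A1_def using A Wc ac by auto
  have A1h: "mat_adjoint A1 = A1"
    unfolding A1_def using A Wc ac Suc.prems(2)
    by (simp add: mat_adjoint_mult[of _ "Suc n" "Suc n" _ "Suc n"] asc)
  have sym: "A1 $$ (i, j) = cnj (A1 $$ (j, i))" if "i < Suc n" "j < Suc n" for i j
    using that A1 mat_adjoint_index[of i A1 j] by (simp add: A1h)
  \<comment> \<open>With w the first column of W, the first column of \<open>A1\<close> is W* A w =
    e W* w, and W* w is the first column of W* W = 1.\<close>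
  have "A1 = mat_adjoint W * (A * W)" unfolding A1_def using A Wc ac by (simp add: asc)
  then have "col A1 0 = mat_adjoint W *\<^sub>v col (A * W) 0"
    using A Wc ac by (simp only:) (rule col_mult2[of _ "Suc n" "Suc n" _ "Suc n"]; simp)
  also have "col (A * W) 0 = A *\<^sub>v col W 0"
    using A Wc by (intro col_mult2[of _ "Suc n" "Suc n" _ "Suc n"]) auto
  also have "A *\<^sub>v col W 0 = e \<cdot>\<^sub>v col W 0"
    using v A by (simp add: W0 mult_mat_vec smult_smult_assoc mult.commute)
  also have "mat_adjoint W *\<^sub>v (e \<cdot>\<^sub>v col W 0) = e \<cdot>\<^sub>v col (mat_adjoint W * W) 0"
    using col_mult2[OF ac Wc, of 0] mult_mat_vec[OF ac, of "col W 0" e] carrier_matD[OF Wc]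
    by (simp only: zero_less_Suc carrier_vecI dim_col)
  finally have col0: "col A1 0 = e \<cdot>\<^sub>v unit_vec (Suc n) 0" by (simp add: WW)
  have A1i0: "A1 $$ (i, 0) = (if i = 0 then e else 0)" if "i < Suc n" for i
    using arg_cong[OF col0, of "\<lambda>x. x $ i"] that A1 by simp
  have A10i: "A1 $$ (0, i) = (if i = 0 then e else 0)" if "i < Suc n" for i
    using that A1i0[of i] sym[of 0 i] sym[of 0 0] A1i0[of 0] by auto
  \<comment> \<open>A diagonal entry of a Hermitian matrix is real.\<close>
  have e: "e = complex_of_real (Re e)"
    using sym[of 0 0] A1i0[of 0] by (simp add: complex_eq_iff)
  define A2 where "A2 = mat n n (\<lambda>(i, j). A1 $$ (Suc i, Suc j))"
  have A2: "A2 \<in> carrier_mat n n" by (simp add: A2_def)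
  have "mat_adjoint A2 = A2"
    by (rule eq_matI) (auto simp: A2_def intro: sym[symmetric])
  then obtain U2 d where U2: "unitary_mat n U2" and A2d: "A2 = U2 * real_diag n d * mat_adjoint U2"
    using Suc.IH[OF A2] by blast
  have U2c: "U2 \<in> carrier_mat n n" and UU2: "mat_adjoint U2 * U2 = 1\<^sub>m n"
    using U2 by (auto simp: unitary_mat_def)
  define V where "V = four_block_mat (1\<^sub>m 1) (0\<^sub>m 1 n) (0\<^sub>m n 1) U2"
  \<comment> \<open>\<open>case_nat\<close> puts the new eigenvalue at index 0 and shifts the others
    by one.\<close>
  define D where "D = real_diag (Suc n) (case_nat (Re e) d)"
  have z: "mat_adjoint (0\<^sub>m p q :: complex mat) = 0\<^sub>m q p" for p q
    by (rule eq_matI) auto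
  have Va: "mat_adjoint V = four_block_mat (1\<^sub>m 1) (0\<^sub>m 1 n) (0\<^sub>m n 1) (mat_adjoint U2)"
    unfolding V_def using U2c by (subst mat_adjoint_four_block) (auto simp: z)
  have "mat_adjoint V * V = four_block_mat (1\<^sub>m 1) (0\<^sub>m 1 n) (0\<^sub>m n 1) (1\<^sub>m n)"
    unfolding Va unfolding V_def using U2c UU2
    by (simp add: mult_block_diag_mat[of _ "Suc 0" _ _ n])
  then have V: "unitary_mat (Suc n) V"
    using four_block_carrier_mat[of "1\<^sub>m 1" 1 1 U2 n n] U2c by (simp add: unitary_mat_def V_def)
  have D: "D = four_block_mat (mat 1 1 (\<lambda>_. e)) (0\<^sub>m 1 n) (0\<^sub>m n 1) (real_diag n d)"
    unfolding D_def using e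
    by (intro eq_matI) (auto simp: real_diag_def mat_diag_def less_Suc_eq_0_disj split: nat.split)
  have "V * D * mat_adjoint V = four_block_mat (mat 1 1 (\<lambda>_. e)) (0\<^sub>m 1 n) (0\<^sub>m n 1) A2"
    unfolding Va D A2d unfolding V_def using U2c by (simp add: mult_block_diag_mat[of _ "Suc 0" _ _ n])
  also have "\<dots> = A1"
    using A1 A1i0 A10i by (intro eq_matI) (auto simp: A2_def)
  finally have A1V: "V * D * mat_adjoint V = A1" .
  have Vc: "V \<in> carrier_mat (Suc n) (Suc n)" using V by (simp add: unitary_mat_def)
  have Dc: "D \<in> carrier_mat (Suc n) (Suc n)" by (simp add: D_def)
  have "W * V * D * mat_adjoint (W * V) = W * (V * D * mat_adjoint V) * mat_adjoint W"
    using Wc Vc Dc by (simp add: mat_adjoint_mult[OF Wc Vc] asc)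
  also have "\<dots> = (W * mat_adjoint W) * A * (W * mat_adjoint W)"
    unfolding A1V unfolding A1_def using A Wc ac by (simp add: asc)
  also have "\<dots> = A" using A unitary_mat_right[OF W] by simp
  finally show ?case using unitary_mat_mult[OF W V] unfolding D_def by metis
qed

section \<open>Eigenvalues read off from a diagonalization\<close>

text \<open>From U* U = 1 one gets A U = U D. Comparing columns gives the eigenvectors, and the
  diagonal of U* U gives their length.\<close>

lemma diagonalization_eigenvector:
  assumes U: "unitary_mat n U" and A: "A = U * real_diag n d * mat_adjoint U" and i: "i < n"
  shows "A *\<^sub>v col U i = complex_of_real (d i) \<cdot>\<^sub>v col U i" and "col U i \<bullet>c col U i = 1"
proof -
  have c: "U \<in> carrier_mat n n" "mat_adjoint U * U = 1\<^sub>m n" using U by (auto simp: unitary_mat_def)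
  have "A * U = U * real_diag n d * (mat_adjoint U * U)"
    unfolding A using c(1) by (intro assoc_mult_mat[of _ n n _ n _ n]) auto
  then have AU: "A * U = U * real_diag n d"
    using c right_mult_one_mat[of "U * real_diag n d" n n] by simp
  have "A *\<^sub>v col U i = col (A * U) i"
    using c i unfolding A by (intro col_mult2[symmetric, of _ n n _ n]) auto
  also have "\<dots> = complex_of_real (d i) \<cdot>\<^sub>v col U i"
    unfolding AU real_diag_def mat_diag_mult_right[OF c(1)] using c i by (intro eq_vecI) auto
  finally show "A *\<^sub>v col U i = complex_of_real (d i) \<cdot>\<^sub>v col U i" .
  show "col U i \<bullet>c col U i = 1"
    using mat_adjoint_mult_self_index[of i U i] c i by simp
qed

text \<open>Each diagonal entry is the value of the quadratic form of A at a unit eigenvector, hence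
  positive.\<close>

lemma positive_definite_diagonalization:
  assumes "positive_definite n A"
  obtains U d where "unitary_mat n U" "\<forall>i<n. 0 < d i" "A = U * real_diag n d * mat_adjoint U"
proof -
  have A: "A \<in> carrier_mat n n" "mat_adjoint A = A"
    and pos: "\<And>x. x \<in> carrier_vec n \<Longrightarrow> x \<noteq> 0\<^sub>v n \<Longrightarrow> 0 < Re ((A *\<^sub>v x) \<bullet>c x)"
    using assms by (auto simp: positive_definite_def)
  obtain U d where U: "unitary_mat n U" and Ad: "A = U * real_diag n d * mat_adjoint U"
    using hermitian_diagonalization[OF A] by blast
  have "0 < d i" if i: "i < n" for i
  proof -
    note ev = diagonalization_eigenvector[OF U Ad i]
    have x: "col U i \<in> carrier_vec n" using U by (auto simp: unitary_mat_def)
    moreover have "col U i \<noteq> 0\<^sub>v n" using ev(2) by auto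
    ultimately show ?thesis using pos[of "col U i"] ev x by simp
  qed
  then show ?thesis using that U Ad by blast
qed

text \<open>This links the diagonal entries to the eigenvalues listed by the characteristic
  polynomial. Membership, without order or multiplicity, suffices to compare with a minimum over all
  pairs.\<close>

lemma diagonalization_eigenvalue:
  assumes U: "unitary_mat n U" and A: "A = U * real_diag n d * mat_adjoint U" and i: "i < n"
    and cp: "char_poly A = (\<Prod>i = 1..n. [:- complex_of_real (lam i), 1:])"
  shows "\<exists>k\<in>{1..n}. d i = lam k"
proof -
  have Ac: "A \<in> carrier_mat n n" and x: "col U i \<in> carrier_vec n"
    using U unfolding A by (auto simp: unitary_mat_def)
  note ev = diagonalization_eigenvector[OF U A i]
  have "col U i \<noteq> 0\<^sub>v n" using ev(2) by auto
  then have "eigenvalue A (complex_of_real (d i))"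
    using ev(1) x Ac by (auto simp: eigenvalue_def eigenvector_def)
  then have "poly (char_poly A) (complex_of_real (d i)) = 0"
    using eigenvalue_root_char_poly[OF Ac] by simp
  then show ?thesis unfolding cp poly_prod by auto
qed

section \<open>Schur multipliers in a pair of eigenbases\<close>

text \<open>
  Written in the eigenbases of A and B, the product f(A) X g(B) is the Schur product of X with
  the matrix of the values f(a_i) g(b_j).
\<close>

definition sandwich ::
    "nat \<Rightarrow> complex mat \<Rightarrow> complex mat \<Rightarrow> complex mat \<Rightarrow> (nat \<Rightarrow> nat \<Rightarrow> real) \<Rightarrow> complex mat" where
  "sandwich n U V Y f = U * mat n n (\<lambda>(i, j). complex_of_real (f i j) * Y $$ (i, j)) * mat_adjoint V"

lemma sandwich_mult:
  assumes U: "unitary_mat n U" and V: "unitary_mat n V" and X: "X \<in> carrier_mat n n"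
  shows "U * real_diag n f * mat_adjoint U * X * (V * real_diag n g * mat_adjoint V) =
    sandwich n U V (mat_adjoint U * X * V) (\<lambda>i j. f i * g j)"
proof -
  have c: "U \<in> carrier_mat n n" "V \<in> carrier_mat n n" using U V by (auto simp: unitary_mat_def)
  define Y where "Y = mat_adjoint U * X * V"
  have Y: "Y \<in> carrier_mat n n" unfolding Y_def using c X by auto
  \<comment> \<open>The left diagonal factor scales row i by \<open>f i\<close>, the right one
    scales column j by \<open>g j\<close>.\<close>
  have "mat n n (\<lambda>(i, j). complex_of_real (f i * g j) * Y $$ (i, j)) = real_diag n f * Y * real_diag n g"
    unfolding real_diag_def mat_diag_mult_left[OF Y]
    by (subst mat_diag_mult_right) (auto intro!: eq_matI)
  then show ?thesis
    unfolding sandwich_def Y_def[symmetric]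
    unfolding Y_def using c X by (simp add: square_mat_mult_simps[where n = n])
qed

lemma sandwich_linear:
  assumes U: "unitary_mat n U" and V: "unitary_mat n V"
  shows "complex_of_real s \<cdot>\<^sub>m sandwich n U V Y f + complex_of_real t \<cdot>\<^sub>m sandwich n U V Y g =
      sandwich n U V Y (\<lambda>i j. s * f i j + t * g i j)" (is ?add)
    and "sandwich n U V Y f - sandwich n U V Y g = sandwich n U V Y (\<lambda>i j. f i j - g i j)" (is ?diff)
proof -
  have c: "U \<in> carrier_mat n n" "mat_adjoint V \<in> carrier_mat n n"
    using U V by (auto simp: unitary_mat_def)
  let ?M = "\<lambda>f. mat n n (\<lambda>(i, j). complex_of_real (f i j) * Y $$ (i, j))"
  have M: "?M f \<in> carrier_mat n n" for f by simp
  have "?M (\<lambda>i j. s * f i j + t * g i j) = complex_of_real s \<cdot>\<^sub>m ?M f + complex_of_real t \<cdot>\<^sub>m ?M g"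
    by (rule eq_matI) (auto simp: algebra_simps)
  then show ?add
    unfolding sandwich_def using c M
    by (simp add: mult_add_distrib_mat[of _ n n _ n] add_mult_distrib_mat[of _ n n _ _ n]
        mult_smult_distrib[of _ n n _ n] mult_smult_assoc_mat[of _ n n _ n])
  have "?M (\<lambda>i j. f i j - g i j) = ?M f - ?M g"
    by (rule eq_matI) (auto simp: algebra_simps)
  then show ?diff
    unfolding sandwich_def using c M
    by (simp add: mult_minus_distrib_mat[of _ n n _ n] minus_mult_distrib_mat[of _ n n _ _ n])
qed

lemma frobenius_norm_sandwich:
  assumes "unitary_mat n U" "unitary_mat n V"
  shows "(frobenius_norm (sandwich n U V Y f))\<^sup>2 =
    (\<Sum>i<n. \<Sum>j<n. (f i j)\<^sup>2 * (cmod (Y $$ (i, j)))\<^sup>2)"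
proof -
  have "(frobenius_norm (sandwich n U V Y f))\<^sup>2 =
    (frobenius_norm (mat n n (\<lambda>(i, j). complex_of_real (f i j) * Y $$ (i, j))))\<^sup>2"
    unfolding sandwich_def using assms by (intro frobenius_norm_unitary) auto
  then show ?thesis by (simp add: frobenius_norm_sq norm_mult power_mult_distrib)
qed

section \<open>Summation over the pairs of eigenvalues\<close>

theorem theorem4p1:
  fixes n :: nat
    and A B X :: "complex mat"
    and lam nu :: "nat \<Rightarrow> real"
    and v r r1 r1' K :: real
  assumes "n \<ge> 1"
    and "A \<in> carrier_mat n n" and "B \<in> carrier_mat n n" and "X \<in> carrier_mat n n"
    and "positive_definite n A" and "positive_definite n B"
    and "char_poly A = (\<Prod>i = 1..n. [:- complex_of_real (lam i), 1:])"
    and "char_poly B = (\<Prod>j = 1..n. [:- complex_of_real (nu j), 1:])"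
    and "K = Min {kantorovich2 ((lam i / nu j) powr (1/2)) | i j. i \<in> {1..n} \<and> j \<in> {1..n}}"
    and "0 < v" and "v < 1"
    and "r = min v (1 - v)"
    and "r1 = min (2 * r) (1 - 2 * r)"
    and "r1' = min (2 * r1) (1 - 2 * r1)"
  shows "(v \<le> 1/2 \<longrightarrow>
      (frobenius_norm (complex_of_real (1 - v) \<cdot>\<^sub>m (A * X) + complex_of_real v \<cdot>\<^sub>m (X * B)))\<^sup>2
        - v\<^sup>2 * (frobenius_norm (A * X - X * B))\<^sup>2
      \<ge> r1 * (frobenius_norm (mat_rpow A (1/2) * X * mat_rpow B (1/2) - A * X))\<^sup>2
        + K powr r1' * (frobenius_norm (mat_rpow A (1 - v) * X * mat_rpow B v))\<^sup>2)
    \<and> (1/2 < v \<longrightarrow>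
      (frobenius_norm (complex_of_real (1 - v) \<cdot>\<^sub>m (A * X) + complex_of_real v \<cdot>\<^sub>m (X * B)))\<^sup>2
        - (1 - v)\<^sup>2 * (frobenius_norm (A * X - X * B))\<^sup>2
      \<ge> r1 * (frobenius_norm (mat_rpow A (1/2) * X * mat_rpow B (1/2) - X * B))\<^sup>2
        + K powr r1' * (frobenius_norm (mat_rpow A (1 - v) * X * mat_rpow B v))\<^sup>2)"
proof -
  have X: "X \<in> carrier_mat n n" by fact
  obtain U d where U: "unitary_mat n U" and d: "\<forall>i<n. 0 < d i"
    and A: "A = U * real_diag n d * mat_adjoint U"
    using positive_definite_diagonalization[OF assms(5)] .
  obtain V e where V: "unitary_mat n V" and e: "\<forall>j<n. 0 < e j"
    and B: "B = V * real_diag n e * mat_adjoint V"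
    using positive_definite_diagonalization[OF assms(6)] .
  define Y where "Y = mat_adjoint U * X * V"
  let ?S = "sandwich n U V Y"
  have one: "real_diag n (\<lambda>_. 1) = 1\<^sub>m n" by (simp add: real_diag_def)
  have Uc: "U \<in> carrier_mat n n" and Vc: "V \<in> carrier_mat n n"
    using U V by (auto simp: unitary_mat_def)
  have idU: "U * real_diag n (\<lambda>_. 1) * mat_adjoint U = 1\<^sub>m n"
    and idV: "V * real_diag n (\<lambda>_. 1) * mat_adjoint V = 1\<^sub>m n"
    using Uc Vc unitary_mat_right[OF U] unitary_mat_right[OF V] by (simp_all add: one)
  \<comment> \<open>The missing right factor is the identity, written as the constant function 1 of
    B; for \<open>XB\<close> it is that function of A.\<close>
  have AX: "A * X = ?S (\<lambda>i j. d i)"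
    using sandwich_mult[OF U V X, of d "\<lambda>_. 1"] assms(2) X by (simp add: idV A[symmetric] Y_def)
  have XB: "X * B = ?S (\<lambda>i j. e j)"
    using sandwich_mult[OF U V X, of "\<lambda>_. 1" e] assms(3) X by (simp add: idU B[symmetric] Y_def)
  have pow: "mat_rpow A s * X * mat_rpow B t = ?S (\<lambda>i j. d i powr s * e j powr t)" for s t
    unfolding mat_rpow_eq[OF U d A] mat_rpow_eq[OF V e B] Y_def by (rule sandwich_mult[OF U V X])
  \<comment> \<open>The upper bound holds because the constant of the pair (\<open>d i\<close>,
    \<open>e j\<close>) lies in the set that is minimized; nonnegativity makes powers of
    \<open>K\<close> monotone in the base.\<close>
  have K: "0 \<le> K \<and> K \<le> kantorovich2 ((d i / e j) powr (1/2))" if i: "i < n" and j: "j < n" for i j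
  proof -
    let ?k = "\<lambda>i j. kantorovich2 ((lam i / nu j) powr (1/2))"
    let ?S = "{?k i j | i j. i \<in> {1..n} \<and> j \<in> {1..n}}"
    have S: "?S \<subseteq> (\<lambda>(i, j). ?k i j) ` ({1..n} \<times> {1..n})" by auto
    have fin: "finite ?S" by (rule finite_subset[OF S]) simp
    obtain k where k: "k \<in> {1..n}" "d i = lam k"
      using diagonalization_eigenvalue[OF U A i assms(7)] by blast
    obtain l where l: "l \<in> {1..n}" "e j = nu l"
      using diagonalization_eigenvalue[OF V B j assms(8)] by blast
    have mem: "?k k l \<in> ?S" using k l by blast
    have "K \<in> ?S" unfolding assms(9) using fin mem by (intro Min_in) blast+
    \<comment> \<open>A real power is nonnegative for every base, so the signs of \<open>lam\<close>
      and \<open>nu\<close> do not enter; at power 0 the quotient is 0 by the convention for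
      division by zero.\<close>
    moreover have "0 \<le> kantorovich2 (x powr (1/2))" for x
      by (simp add: kantorovich2_def)
    ultimately have "0 \<le> K" by auto
    moreover have "K \<le> ?k k l" unfolding assms(9) using fin mem by (rule Min_le)
    ultimately show ?thesis using k l by simp
  qed
  \<comment> \<open>The scalar inequality for each pair is multiplied by |y_ij|^2 and summed. The
    shape is that of both claims once \<open>sum_distrib_left\<close> has moved the scalar factors
    inside the sums.\<close>
  have sums: "(\<Sum>i<n. \<Sum>j<n. a * ((f i j)\<^sup>2 * (cmod (Y $$ (i, j)))\<^sup>2)) +
      (\<Sum>i<n. \<Sum>j<n. b * ((g i j)\<^sup>2 * (cmod (Y $$ (i, j)))\<^sup>2))
    \<le> (\<Sum>i<n. \<Sum>j<n. (h i j)\<^sup>2 * (cmod (Y $$ (i, j)))\<^sup>2) -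
      (\<Sum>i<n. \<Sum>j<n. c * ((k i j)\<^sup>2 * (cmod (Y $$ (i, j)))\<^sup>2))"
    if "\<And>i j. i < n \<Longrightarrow> j < n \<Longrightarrow> a * (f i j)\<^sup>2 + b * (g i j)\<^sup>2 \<le> (h i j)\<^sup>2 - c * (k i j)\<^sup>2"
    for a b c and f g h k :: "nat \<Rightarrow> nat \<Rightarrow> real"
    unfolding sum.distrib[symmetric] sum_subtractf[symmetric]
  proof (intro sum_mono)
    fix i j assume "i \<in> {..<n}" "j \<in> {..<n}"
    then have "(a * (f i j)\<^sup>2 + b * (g i j)\<^sup>2) * (cmod (Y $$ (i, j)))\<^sup>2
        \<le> ((h i j)\<^sup>2 - c * (k i j)\<^sup>2) * (cmod (Y $$ (i, j)))\<^sup>2"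
      using that by (intro mult_right_mono) auto
    then show "a * ((f i j)\<^sup>2 * (cmod (Y $$ (i, j)))\<^sup>2) + b * ((g i j)\<^sup>2 * (cmod (Y $$ (i, j)))\<^sup>2)
        \<le> (h i j)\<^sup>2 * (cmod (Y $$ (i, j)))\<^sup>2 - c * ((k i j)\<^sup>2 * (cmod (Y $$ (i, j)))\<^sup>2)"
      by (simp add: algebra_simps)
  qed
  show ?thesis
    unfolding AX XB pow sandwich_linear[OF U V] frobenius_norm_sandwich[OF U V] sum_distrib_left
  proof (intro conjI impI sums)
    fix i j assume v: "v \<le> 1/2" and ij: "i < n" "j < n"
    have "r1 = min (2 * v) (1 - 2 * v)" using v assms(12,13) by simp
    then show "r1 * (d i powr (1/2) * e j powr (1/2) - d i)\<^sup>2 +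
        K powr r1' * (d i powr (1 - v) * e j powr v)\<^sup>2
      \<le> ((1 - v) * d i + v * e j)\<^sup>2 - v\<^sup>2 * (d i - e j)\<^sup>2"
      unfolding assms(14) using d e v ij assms(10) K[OF ij] by (simp only:) (intro Young_kantorovich_sq_diff; simp)
  next
    fix i j assume v: "1/2 < v" and ij: "i < n" "j < n"
    have de: "0 < d i" "0 < e j" using d e ij by auto
    have r1: "r1 = min (2 * (1 - v)) (1 - 2 * (1 - v))" using v assms(12,13) by simp
    \<comment> \<open>Exchanging the eigenvalues inverts the ratio, which leaves the constant
      unchanged, so the same \<open>K\<close> serves as a lower bound.\<close>
    have "(e j / d i) powr (1/2) = 1 / (d i / e j) powr (1/2)"
      using de by (simp add: powr_divide)
    then have "K \<le> kantorovich2 ((e j / d i) powr (1/2))"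
      using K[OF ij] de by (simp add: kantorovich2_inverse)
    \<comment> \<open>This is the scalar inequality of case (I) at a = \<open>e j\<close>, b =
      \<open>d i\<close> with weight 1 - v, which is below 1/2.\<close>
    then have "r1 * (e j powr (1/2) * d i powr (1/2) - e j)\<^sup>2 +
        K powr r1' * (e j powr (1 - (1 - v)) * d i powr (1 - v))\<^sup>2
      \<le> ((1 - (1 - v)) * e j + (1 - v) * d i)\<^sup>2 - (1 - v)\<^sup>2 * (e j - d i)\<^sup>2"
      unfolding assms(14) r1 using de v assms(11) K[OF ij] by (intro Young_kantorovich_sq_diff) auto
    then show "r1 * (d i powr (1/2) * e j powr (1/2) - e j)\<^sup>2 +
        K powr r1' * (d i powr (1 - v) * e j powr v)\<^sup>2
      \<le> ((1 - v) * d i + v * e j)\<^sup>2 - (1 - v)\<^sup>2 * (d i - e j)\<^sup>2"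
      by (simp add: mult.commute add.commute power2_commute[of "e j"])
  qed
qed

end
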